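(* Let $d\geq 1$ and let $M$ be a real $d\times d$ matrix. Let $V$, $S$, $W$ be $d\times d$ matrices such that $M=VSW^T$ is a singular value decomposition of $M$. If $\det(VW)>0$, then $U=WV^T$ is a rotation matrix that maximizes $\mathrm{tr}(UM)$ over all $d\times d$ rotation matrices $U$. Otherwise, if $\det(VW)<0$, then with $\tilde{S}=\mathrm{diag}\{s_1,\ldots,s_d\}$, $s_1=\cdots=s_{d-1}=1$, $s_d=-1$, the matrix $U=W\tilde{S}V^T$ is a rotation matrix that maximizes $\mathrm{tr}(UM)$ over all $d\times d$ rotation matrices $U$.
   Context: All matrices are real. A rotation matrix is an orthogonal matrix of determinant $1$. $\mathrm{tr}$ denotes the trace, and $\mathrm{diag}\{s_1,\ldots,s_d\}$ is the $d\times d$ diagonal matrix with diagonal entries $s_1,\ldots,s_d$ in that order from upper left to lower right. A singular value decomposition of a $d\times d$ matrix $M$ is a representation $M=VSW^T$, where $V$ and $W$ are $d\times d$ orthogonal matrices and $S$ is a $d\times d$ diagonal matrix whose diagonal entries are the singular values of $M$ (nonnegative real numbers), in descending order from the upper left to the lower right of $S$. *)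

theory Defs
  imports "HOL-Analysis.Analysis" "HOL-Computational_Algebra.Polynomial"
begin

text \<open>
  Square matrices of size d are elements of \<open>real^'n^'n\<close> with \<open>CARD('n) = d\<close>; the linear order on
  the index type says what ``from upper left to lower right'' means. The first index is the row.
\<close>

definition diag_matrix :: "('n \<Rightarrow> 'a::zero) \<Rightarrow> 'a^'n^'n" where
  "diag_matrix s = (\<chi> i j. if i = j then s i else 0)"

definition charpoly :: "'a::comm_ring_1^'n^'n \<Rightarrow> 'a poly" where
  "charpoly A = det (mat [:0, 1:] - map_matrix (\<lambda>a. [:a:]) A)"

text \<open>
  All complex roots of the characteristic polynomial below are real and nonnegative, so this is a
  multiset of size d.
\<close>

definition singular_values :: "real^'n^'n \<Rightarrow> real multiset" where
  "singular_values M = image_mset sqrt (proots (charpoly (transpose M ** M)))"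

definition is_svd ::
    "real^'n::{finite,linorder}^'n::{finite,linorder} \<Rightarrow> _ \<Rightarrow> _ \<Rightarrow> _ \<Rightarrow> bool" where
  "is_svd M V S W \<longleftrightarrow>
     M = V ** S ** transpose W \<and>
     orthogonal_matrix V \<and> orthogonal_matrix W \<and>
     (\<exists>\<sigma>. S = diag_matrix \<sigma> \<and>
          image_mset \<sigma> (mset_set UNIV) = singular_values M \<and>
          (\<forall>i. 0 \<le> \<sigma> i) \<and>
          antimono \<sigma>)"

lemma map_matrix_pCons_mul:
  "map_matrix (\<lambda>a. [:a:]) (A ** B) =
     map_matrix (\<lambda>a. [:a:]) A ** map_matrix (\<lambda>a. [:a::'a::comm_ring_1:]) B"
proof -
  have *: "[:\<Sum>k\<in>K. f k:] = (\<Sum>k\<in>K. [:f k::'a:])" for f and K :: "'z set"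
    by (induction K rule: infinite_finite_induct) (simp_all, metis add_pCons add_0)
  show ?thesis
    by (simp add: vec_eq_iff matrix_matrix_mult_def *) (simp add: mult.commute)
qed

lemma charpoly_orthogonal_conj:
  fixes A W :: "'a::comm_ring_1^'n^'n"
  assumes "orthogonal_matrix W"
  shows "charpoly (W ** A ** transpose W) = charpoly A"
proof -
  let ?m = "map_matrix (\<lambda>a. [:a::'a:]) :: 'a^'n^'n \<Rightarrow> 'a poly^'n^'n"
  let ?X = "mat [:0, 1:] :: 'a poly^'n^'n"
  have one: "?m W ** ?m (transpose W) = mat 1"
    using assms by (simp add: orthogonal_matrix_def flip: map_matrix_pCons_mul)
      (simp add: vec_eq_iff map_matrix_def mat_def one_pCons)
  have X: "?m W ** ?X ** ?m (transpose W) = ?X"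
  proof -
    have "?m W ** ?X = ?X ** ?m W"
      by (simp add: vec_eq_iff matrix_matrix_mult_def mat_def if_distrib if_distribR
          mult.commute cong: if_cong)
    then show ?thesis using one by (metis matrix_mul_assoc matrix_mul_rid)
  qed
  have "P ** (Q - R) ** P' = P ** Q ** P' - P ** R ** P'" for P Q R P' :: "'a poly^'n^'n"
    by (simp only: vec_eq_iff matrix_matrix_mult_def vec_lambda_beta vector_minus_component
        right_diff_distrib left_diff_distrib sum_subtractf simp_thms)
  then have "?X - ?m (W ** A ** transpose W) = ?m W ** (?X - ?m A) ** ?m (transpose W)"
    by (simp add: map_matrix_pCons_mul X)
  then have "charpoly (W ** A ** transpose W) = det (?m W ** ?m (transpose W)) * charpoly A"
    by (simp add: charpoly_def det_mul mult_ac)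
  then show ?thesis by (simp add: one)
qed

lemma charpoly_diag: "charpoly (diag_matrix s) = (\<Prod>i\<in>UNIV. [:- s i, 1:])"
  unfolding charpoly_def
  by (subst det_diagonal) (auto simp: diag_matrix_def map_matrix_def mat_def)

lemma singular_values_eq:
  fixes V W :: "real^'n^'n"
  assumes V: "orthogonal_matrix V" and W: "orthogonal_matrix W" and pos: "\<forall>i. 0 \<le> \<sigma> i"
  shows "singular_values (V ** diag_matrix \<sigma> ** transpose W) = image_mset \<sigma> (mset_set UNIV)"
proof -
  let ?S = "diag_matrix \<sigma> :: real^'n^'n" and ?M = "V ** diag_matrix \<sigma> ** transpose W"
  have "transpose ?M ** ?M = W ** (transpose ?S ** (transpose V ** V) ** ?S) ** transpose W"
    by (simp add: matrix_transpose_mul matrix_mul_assoc)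
  also have "transpose ?S ** (transpose V ** V) ** ?S = transpose ?S ** ?S"
    using V by (simp add: orthogonal_matrix_def)
  also have "transpose ?S ** ?S = diag_matrix (\<lambda>i. (\<sigma> i)\<^sup>2)"
  proof -
    have "(\<Sum>k\<in>UNIV. (if k = i then \<sigma> k else 0) * (if k = j then \<sigma> k else 0)) =
        (\<Sum>k\<in>UNIV. if k = i then (if i = j then (\<sigma> i)\<^sup>2 else 0) else 0)" for i j :: 'n
      by (intro sum.cong) (auto simp: power2_eq_square)
    then show ?thesis
      by (simp add: vec_eq_iff diag_matrix_def transpose_def matrix_matrix_mult_def)
  qed
  finally have "charpoly (transpose ?M ** ?M) = (\<Prod>i\<in>UNIV. [:- (\<sigma> i)\<^sup>2, 1:])"
    using W by (simp add: charpoly_orthogonal_conj charpoly_diag)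
  moreover have "proots (\<Prod>i\<in>A. [:- (\<sigma> i)\<^sup>2, 1:]) = image_mset (\<lambda>i. (\<sigma> i)\<^sup>2) (mset_set A)"
    if "finite A" for A
    using that by induction (simp_all add: proots_mult del: mult_pCons_left)
  ultimately show ?thesis
    using pos by (simp add: singular_values_def multiset.map_comp o_def)
qed

text \<open>
  Hence the clause on \<^const>\<open>singular_values\<close> in \<^const>\<open>is_svd\<close> follows from the other clauses.
\<close>

lemma is_svd_iff:
  "is_svd M V S W \<longleftrightarrow>
     M = V ** S ** transpose W \<and> orthogonal_matrix V \<and> orthogonal_matrix W \<and>
     (\<exists>\<sigma>. S = diag_matrix \<sigma> \<and> (\<forall>i. 0 \<le> \<sigma> i) \<and> antimono \<sigma>)"
  (is "_ \<longleftrightarrow> ?R")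
proof
  assume "is_svd M V S W"
  then show ?R by (auto simp: is_svd_def)
next
  assume ?R
  then obtain \<sigma> where "M = V ** S ** transpose W" "orthogonal_matrix V" "orthogonal_matrix W"
    "S = diag_matrix \<sigma>" "\<forall>i. 0 \<le> \<sigma> i" "antimono \<sigma>" by blast
  moreover from this have "image_mset \<sigma> (mset_set UNIV) = singular_values M"
    by (metis singular_values_eq)
  ultimately show "is_svd M V S W" unfolding is_svd_def by blast
qed

end

theory Submission
  imports Defs
begin

text \<open>
  The substitution \<open>Q = W\<^sup>T U V\<close> turns \<open>tr (U M)\<close> into \<open>tr (Q S) = \<Sum>i. Q\<^sub>i\<^sub>i \<sigma>\<^sub>i\<close> and the rotations
  \<open>U\<close> into the orthogonal matrices \<open>Q\<close> with \<open>det Q = det (V W) = \<plusminus>1\<close>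
  (\<open>is_arg_max_trace_rotation\<close>). The diagonal entries of an orthogonal matrix are at most 1, so for
  determinant 1 the optimum is \<open>Q = 1\<close>.

  For determinant -1 the matrix \<open>Q\<close> has the eigenvalue -1, and this costs 2 in the trace:
  \<open>tr Q \<le> d - 2\<close> (\<open>trace_le_of_det_minus_one\<close>). Subtracting the smallest singular value
  \<open>\<sigma>\<^sub>d\<close> from all others then gives
  \[ \sum_i Q_{ii} \sigma_i = \sum_i Q_{ii} (\sigma_i - \sigma_d) + \sigma_d \, tr\, Q
     \le \sum_i (\sigma_i - \sigma_d) + \sigma_d (d - 2) = \sum_{i < d} \sigma_i - \sigma_d, \]
  where the last expression is the value at \<open>Q = diag {1, \<dots>, 1, -1}\<close>.
\<close>

lemma trace_mul_diag_matrix: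
  fixes Q :: "'a::comm_ring_1^'n^'n"
  shows "trace (Q ** diag_matrix s) = (\<Sum>i\<in>UNIV. Q$i$i * s i)"
  by (simp add: trace_def matrix_matrix_mult_def diag_matrix_def if_distrib cong: if_cong)

lemma det_diag_matrix: "det (diag_matrix s) = (\<Prod>i\<in>UNIV. s i)"
  by (subst det_diagonal) (auto simp: diag_matrix_def)

lemma orthogonal_matrix_diag_sign:
  fixes s :: "'n::finite \<Rightarrow> real"
  assumes "\<And>i. (s i)\<^sup>2 = 1"
  shows "orthogonal_matrix (diag_matrix s)"
proof -
  have "(\<Sum>k\<in>UNIV. (if k = i then s k else 0) * (if k = j then s k else 0)) =
      (\<Sum>k\<in>UNIV. if k = i then (if i = j then 1 else 0) else 0)" for i j :: 'n
    using assms[of j] by (intro sum.cong) (auto simp: power2_eq_square)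
  then show ?thesis
    by (simp add: orthogonal_matrix vec_eq_iff diag_matrix_def transpose_def
        matrix_matrix_mult_def mat_def)
qed

lemma orthogonal_matrix_diag_entry_le:
  fixes Q :: "real^'n^'n"
  assumes "orthogonal_matrix Q"
  shows "Q$i$i \<le> 1"
proof -
  have "norm (Q$i) = 1"
    using assms by (simp add: orthogonal_matrix_orthonormal_rows row_def)
  then show ?thesis using component_le_norm_cart[of "Q$i" i] by linarith
qed

text \<open>
  Since \<open>Q + 1 = Q (1 + Q\<^sup>T)\<close>, the determinant of \<open>Q + 1\<close> equals its own negative.
\<close>

lemma orthogonal_matrix_eigenvector_minus_one:
  fixes Q :: "real^'n^'n"
  assumes Q: "orthogonal_matrix Q" and det: "det Q = -1"
  obtains v where "v \<noteq> 0" and "Q *v v = - v"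
proof -
  have "Q + mat 1 = Q ** transpose (Q + mat 1)"
  proof -
    have "transpose (Q + mat 1) = transpose Q + mat 1"
      by (auto simp: vec_eq_iff transpose_def mat_def)
    then show ?thesis
      using Q by (simp add: matrix_add_ldistrib orthogonal_matrix_def add.commute)
  qed
  then have "det (Q + mat 1) = det Q * det (Q + mat 1)"
    by (metis det_mul det_transpose)
  then have "det (Q + mat 1) = 0" using det by simp
  then have "\<not> invertible (Q + mat 1)" by (simp add: invertible_det_nz)
  then obtain v where "v \<noteq> 0" "(Q + mat 1) *v v = 0"
    by (metis invertible_left_inverse matrix_left_invertible_ker)
  then show thesis
    using that by (simp add: matrix_vector_mult_add_rdistrib eq_neg_iff_add_eq_0)
qed

text \<open>
  The squared Frobenius norm of \<open>1 - Q\<close> is \<open>2 (d - tr Q)\<close>. It is at least 4 because \<open>1 - Q\<close>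
  doubles the eigenvector for the eigenvalue -1.
\<close>

lemma trace_le_of_det_minus_one:
  fixes Q :: "real^'n^'n"
  assumes Q: "orthogonal_matrix Q" and det: "det Q = -1"
  shows "trace Q \<le> real CARD('n) - 2"
proof -
  obtain v where v: "v \<noteq> 0" "Q *v v = - v"
    using orthogonal_matrix_eigenvector_minus_one[OF Q det] by blast
  let ?A = "mat 1 - Q"
  have row: "(norm (?A$i))\<^sup>2 = 2 - 2 * Q$i$i" for i
  proof -
    have "(mat 1 :: real^'n^'n)$i = axis i 1"
      by (auto simp: vec_eq_iff mat_def axis_def)
    moreover have "Q$i \<bullet> Q$i = 1"
      using Q by (simp add: orthogonal_matrix_orthonormal_rows row_def norm_eq_1)
    ultimately show ?thesis
      by (simp add: power2_norm_eq_inner inner_diff inner_commute[of "axis i 1" "Q$i"]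
          inner_axis inner_axis_axis)
  qed
  have entry: "(?A *v v)$i = 2 * v$i" for i
    using v(2) by (simp add: matrix_vector_mult_diff_rdistrib)
  have "4 * (norm v)\<^sup>2 = (\<Sum>i\<in>UNIV. ((?A *v v)$i)\<^sup>2)"
    unfolding entry
    by (simp add: power2_norm_eq_inner inner_vec_def power_mult_distrib sum_distrib_left
        flip: power2_eq_square)
  also have "\<dots> \<le> (\<Sum>i\<in>UNIV. (norm (?A$i))\<^sup>2 * (norm v)\<^sup>2)"
    by (intro sum_mono)
      (simp only: matrix_vector_mul_component power2_norm_eq_inner Cauchy_Schwarz_ineq)
  also have "\<dots> = (2 * (real CARD('n) - trace Q)) * (norm v)\<^sup>2"
    unfolding row by (simp add: sum_subtractf trace_def flip: sum_distrib_left sum_distrib_right)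
  finally show ?thesis using v(1) by simp
qed

lemma trace_mul_diag_le_of_det_minus_one:
  fixes Q :: "real^'n^'n"
  assumes Q: "orthogonal_matrix Q" and det: "det Q = -1"
    and pos: "0 \<le> \<sigma> m" and min: "\<And>i. \<sigma> m \<le> \<sigma> i"
  shows "trace (Q ** diag_matrix \<sigma>) \<le> (\<Sum>i\<in>UNIV. \<sigma> i) - 2 * \<sigma> m"
proof -
  have "trace (Q ** diag_matrix \<sigma>) = (\<Sum>i\<in>UNIV. Q$i$i * (\<sigma> i - \<sigma> m)) + trace Q * \<sigma> m"
    unfolding trace_mul_diag_matrix
    by (simp add: trace_def right_diff_distrib sum_subtractf flip: sum_distrib_right)
  also have "\<dots> \<le> (\<Sum>i\<in>UNIV. 1 * (\<sigma> i - \<sigma> m)) + (real CARD('n) - 2) * \<sigma> m"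
    using orthogonal_matrix_diag_entry_le[OF Q] trace_le_of_det_minus_one[OF Q det] pos min
    by (intro add_mono sum_mono mult_right_mono) auto
  also have "\<dots> = (\<Sum>i\<in>UNIV. \<sigma> i) - 2 * \<sigma> m"
    by (simp add: sum_subtractf algebra_simps)
  finally show ?thesis .
qed

text \<open>
  The map \<open>U \<mapsto> W\<^sup>T U V\<close> is a bijection from the rotations onto the orthogonal matrices whose
  determinant is that of \<open>V W\<close>, and it carries \<open>tr (U M)\<close> to \<open>tr (Q S)\<close>. So an optimal \<open>T\<close> there
  pulls back to the optimal rotation \<open>W T V\<^sup>T\<close>.
\<close>

lemma is_arg_max_trace_rotation:
  fixes V S W T :: "real^'n^'n"
  assumes V: "orthogonal_matrix V" and W: "orthogonal_matrix W"
    and T: "orthogonal_matrix T" and det: "det T = det (V ** W)"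
    and opt: "\<And>Q. orthogonal_matrix Q \<Longrightarrow> det Q = det T \<Longrightarrow> trace (Q ** S) \<le> trace (T ** S)"
  shows "is_arg_max (\<lambda>U. trace (U ** (V ** S ** transpose W))) rotation_matrix
           (W ** T ** transpose V)"
proof -
  have tr: "trace (U ** (V ** S ** transpose W)) = trace ((transpose W ** U ** V) ** S)" for U
    using trace_mul_sym[of "U ** V ** S" "transpose W"] by (simp add: matrix_mul_assoc)
  have "transpose W ** (W ** T ** transpose V) ** V
      = (transpose W ** W) ** T ** (transpose V ** V)"
    by (simp only: matrix_mul_assoc)
  then have QT: "transpose W ** (W ** T ** transpose V) ** V = T"
    using V W by (simp add: orthogonal_matrix_def)
  have sq: "det V * det V = 1" "det W * det W = 1"
    using det_orthogonal_matrix[OF V] det_orthogonal_matrix[OF W] by auto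
  have "det (W ** T ** transpose V) = (det V * det V) * (det W * det W)"
    by (simp only: det_mul det_transpose det mult_ac)
  then have feasible: "rotation_matrix (W ** T ** transpose V)"
    using V W T sq
    by (simp add: rotation_matrix_def orthogonal_matrix_mul)
  have "trace (U ** (V ** S ** transpose W)) \<le> trace (T ** S)" if "rotation_matrix U" for U
    unfolding tr
  proof (rule opt)
    show "orthogonal_matrix (transpose W ** U ** V)"
      using that V W by (simp add: rotation_matrix_def orthogonal_matrix_mul)
    show "det (transpose W ** U ** V) = det T"
      using that by (simp add: rotation_matrix_def det det_mul)
  qed
  then show ?thesis
    using feasible by (auto simp: is_arg_max_linorder tr QT)
qed

theorem theorem1:
  fixes M V S W :: "real^'n::{finite,linorder}^'n::{finite,linorder}"
  assumes "is_svd M V S W"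
  shows "(det (V ** W) > 0 \<longrightarrow>
            is_arg_max (\<lambda>U. trace (U ** M)) rotation_matrix (W ** transpose V)) \<and>
         (det (V ** W) < 0 \<longrightarrow>
            is_arg_max (\<lambda>U. trace (U ** M)) rotation_matrix
              (W ** diag_matrix (\<lambda>i. if i = Max UNIV then -1 else 1) ** transpose V))"
proof -
  obtain \<sigma> where M: "M = V ** S ** transpose W"
    and V: "orthogonal_matrix V" and W: "orthogonal_matrix W"
    and S: "S = diag_matrix \<sigma>" and pos: "\<And>i. 0 \<le> \<sigma> i" and "antimono \<sigma>"
    using assms unfolding is_svd_def by blast
  define m :: 'n where "m = Max UNIV"
  have min: "\<sigma> m \<le> \<sigma> i" for i
    using \<open>antimono \<sigma>\<close> by (auto simp: m_def antimono_def)
  have det_VW: "det (V ** W) = 1 \<or> det (V ** W) = -1"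
    using det_orthogonal_matrix orthogonal_matrix_mul V W by blast
  have "is_arg_max (\<lambda>U. trace (U ** M)) rotation_matrix (W ** transpose V)"
    if "det (V ** W) > 0"
  proof -
    have "trace (Q ** S) \<le> trace (mat 1 ** S)" if "orthogonal_matrix Q" for Q
      unfolding S trace_mul_diag_matrix
      by (intro sum_mono mult_right_mono)
        (auto simp: mat_def pos orthogonal_matrix_diag_entry_le[OF that])
    then show ?thesis
      using is_arg_max_trace_rotation[OF V W orthogonal_matrix_id, of S] that det_VW
      by (auto simp: M)
  qed
  moreover have "is_arg_max (\<lambda>U. trace (U ** M)) rotation_matrix
      (W ** diag_matrix (\<lambda>i. if i = m then -1 else 1) ** transpose V)"
    if "det (V ** W) < 0"
  proof -
    let ?s = "\<lambda>i. if i = m then -1 else 1 :: real"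
    have det_s: "det (diag_matrix ?s) = -1"
      by (simp add: det_diag_matrix)
    have "(\<Sum>i\<in>UNIV. ?s i * \<sigma> i) = (\<Sum>i\<in>UNIV. \<sigma> i - (if i = m then 2 * \<sigma> m else 0))"
      by (intro sum.cong) auto
    then have "trace (diag_matrix ?s ** S) = (\<Sum>i\<in>UNIV. \<sigma> i) - 2 * \<sigma> m"
      unfolding S trace_mul_diag_matrix by (simp add: diag_matrix_def sum_subtractf)
    then have "trace (Q ** S) \<le> trace (diag_matrix ?s ** S)"
      if "orthogonal_matrix Q" "det Q = -1" for Q
      using trace_mul_diag_le_of_det_minus_one[OF that, of \<sigma> m] pos min by (simp add: S)
    moreover have "orthogonal_matrix (diag_matrix ?s)"
      by (intro orthogonal_matrix_diag_sign) auto
    ultimately show ?thesis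
      unfolding M using that det_VW det_s by (intro is_arg_max_trace_rotation V W) auto
  qed
  ultimately show ?thesis by (simp add: m_def)
qed

end
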